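(* For the generalized hypergeometric-Mittag-Leffler functions ${}_{{}_qF_{q+1}}E_{(\alpha,\beta)}(a_1,\dots,a_q;b_1,\dots,b_{q+1};u)$, with $\alpha,\beta\in\mathbb{R}^{+}$, the following integral representation holds true: $$\int_{-\infty}^{\infty}e^{-\delta u^2}\;{}_{{}_qF_{q+1}}E_{(\alpha,\beta)}(a_1,\dots,a_q;b_1,\dots,b_{q+1};u)\,du$$ $$=\sqrt{\frac{\pi}{\delta}}\;\;{}_{{}_{2q+1}F_{2(q+1)}}E_{(2\alpha,\beta)}\!\left(\frac{a_1}{2},\frac{a_1+1}{2},\dots,\frac{a_q}{2},\frac{a_q+1}{2},\frac12;\;\frac{b_1}{2},\frac{b_1+1}{2},\dots,\frac{b_{q+1}}{2},\frac{b_{q+1}+1}{2};\;\frac{1}{4\delta}\right).$$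
   Context: $(a)_r=\Gamma(a+r)/\Gamma(a)$ is the Pochhammer symbol. The generalized hypergeometric-Mittag-Leffler functions are given by $${}_{{}_pF_q}E_{(\alpha,\beta)}(a_1,\dots,a_p;b_1,\dots,b_q;u)=\sum_{r=0}^{\infty}\frac{(a_1)_r\cdots(a_p)_r}{(b_1)_r\cdots(b_q)_r}\,\frac{u^r}{\Gamma(\alpha r+\beta)} .$$ *)

theory Defs
  imports "HOL-Analysis.Analysis"
begin

text \<open>
  The parameter lists \<open>as\<close> and \<open>bs\<close> hold \<open>a\<^sub>1, \<dots>, a\<^sub>p\<close> and \<open>b\<^sub>1, \<dots>, b\<^sub>q\<close>. The symbol \<open>(a)\<^sub>r\<close> is
  the library's \<^const>\<open>pochhammer\<close>, which equals \<open>\<Gamma>(a + r) / \<Gamma>(a)\<close> whenever \<open>a\<close> is not a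
  non-positive integer (\<open>pochhammer_Gamma\<close>) and extends that quotient continuously to the
  remaining \<open>a\<close>, where the HOL quotient would be \<open>0\<close>.
\<close>

definition hypergeom_ML ::
    "real \<Rightarrow> real \<Rightarrow> complex list \<Rightarrow> complex list \<Rightarrow> complex \<Rightarrow> complex" where
  "hypergeom_ML \<alpha> \<beta> as bs u =
     (\<Sum>r. (\<Prod>a\<leftarrow>as. pochhammer a r) / (\<Prod>b\<leftarrow>bs. pochhammer b r) *
           (u ^ r / of_real (Gamma (\<alpha> * real r + \<beta>))))"

definition halves :: "complex list \<Rightarrow> complex list" where
  "halves cs = concat (map (\<lambda>c. [c / 2, (c + 1) / 2]) cs)"

end

theory Submission
  imports Defs "HOL-Probability.Distributions"
begin

text \<open>
  The coefficients of the series are \<open>O(M\<^sup>r / r!)\<close>, so its partial sums are bounded by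
  \<open>C exp (M |u|)\<close> and dominated convergence allows termwise integration against the Gaussian.
  The odd moments of \<open>exp (- \<delta> u\<^sup>2)\<close> vanish and the even ones are
  \<open>\<surd>(\<pi>/\<delta>) (1/2)\<^sub>m / \<delta>\<^sup>m\<close>; the duplication formula
  \<open>(c)\<^bsub>2m\<^esub> = 4\<^sup>m (c/2)\<^sub>m ((c+1)/2)\<^sub>m\<close> then turns the coefficients of even index into those of
  the right-hand side, the one surplus lower parameter accounting for the factor \<open>1/4\<close> in its argument.
\<close>

section \<open>Complex Gaussian moments\<close>

lemma integrable_exp_minus_square:
  fixes d :: real
  assumes "d > 0"
  shows "integrable lborel (\<lambda>u::real. exp (- d * u\<^sup>2))"
proof -
  \<comment> \<open>The standard deviation for which the exponent -u^2/(2 s^2) of the normal density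
    becomes -d u^2.\<close>
  define s where "s = sqrt (1 / (2 * d))"
  have s: "s > 0" "s\<^sup>2 = 1 / (2 * d)"
    using assms by (auto simp: s_def)
  have "integrable lborel (\<lambda>u. sqrt (2 * pi * s\<^sup>2) * normal_density 0 s u)"
    using s by (intro integrable_mult_right) simp
  also have "(\<lambda>u. sqrt (2 * pi * s\<^sup>2) * normal_density 0 s u) = (\<lambda>u. exp (- d * u\<^sup>2))"
    using s assms by (auto simp: normal_density_def fun_eq_iff field_simps)
  finally show ?thesis .
qed

lemma integral_exp_minus_square:
  fixes d :: real
  assumes "d > 0"
  shows "(\<integral>u. exp (- d * u\<^sup>2) \<partial>lborel) = sqrt (pi / d)"
proof -
  define s where "s = sqrt (1 / (2 * d))"
  have s: "s > 0" "s\<^sup>2 = 1 / (2 * d)"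
    using assms by (auto simp: s_def)
  have "(\<lambda>u. exp (- d * u\<^sup>2)) = (\<lambda>u. sqrt (2 * pi * s\<^sup>2) * normal_density 0 s u)"
    using s assms by (auto simp: normal_density_def fun_eq_iff field_simps)
  then have "(\<integral>u. exp (- d * u\<^sup>2) \<partial>lborel) = sqrt (2 * pi * s\<^sup>2) * (\<integral>u. normal_density 0 s u \<partial>lborel)"
    by simp
  also have "\<dots> = sqrt (pi / d)"
    using s by simp
  finally show ?thesis .
qed

text \<open>Completing the square: half of the Gaussian exponent absorbs the linear growth at the
  cost of a constant. This supplies the dominating functions both for single moments and for the
  whole series.\<close>

lemma exp_linear_minus_square_le:
  fixes d M u :: real
  assumes "d > 0"
  shows "exp (- d * u\<^sup>2) * exp (M * \<bar>u\<bar>) \<le> exp (M\<^sup>2 / (2 * d)) * exp (- (d / 2) * u\<^sup>2)"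
proof -
  have "0 \<le> (d * \<bar>u\<bar> - M)\<^sup>2 / (2 * d)"
    using assms by simp
  also have "\<dots> = d / 2 * u\<^sup>2 - M * \<bar>u\<bar> + M\<^sup>2 / (2 * d)"
    using assms by (simp add: power2_eq_square field_simps)
  finally show ?thesis
    by (simp flip: exp_add)
qed

lemma abs_power_le_fact_exp: "\<bar>u\<bar> ^ k \<le> fact k * exp \<bar>u\<bar>" for u :: real
proof -
  have "(\<Sum>n\<in>{k}. \<bar>u\<bar> ^ n /\<^sub>R fact n) \<le> exp \<bar>u\<bar>"
    unfolding exp_def by (rule sum_le_suminf[OF summable_exp_generic]) auto
  then show ?thesis
    by (simp add: field_simps)
qed

text \<open>The power is at most k! exp |u|, and the case M = 1 of the preceding absorption then
  leaves a Gaussian of half the rate. Integrability of the moment integrands and their decay at both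
  infinities follow from this one bound.\<close>

lemma abs_power_exp_minus_square_le:
  fixes d u :: real
  assumes "d > 0"
  shows "\<bar>u\<bar> ^ k * exp (- d * u\<^sup>2) \<le> fact k * exp (1 / (2 * d)) * exp (- (d / 2) * u\<^sup>2)"
proof -
  have "\<bar>u\<bar> ^ k * exp (- d * u\<^sup>2) \<le> fact k * (exp (- d * u\<^sup>2) * exp (1 * \<bar>u\<bar>))"
    using mult_right_mono[OF abs_power_le_fact_exp[of u k], of "exp (- d * u\<^sup>2)"] by (simp add: mult_ac)
  also have "\<dots> \<le> fact k * (exp (1\<^sup>2 / (2 * d)) * exp (- (d / 2) * u\<^sup>2))"
    by (intro mult_left_mono exp_linear_minus_square_le assms) auto
  finally show ?thesis
    by (simp add: mult_ac)
qed

lemma norm_power_gaussian: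
  "norm (complex_of_real u ^ k * exp (- \<delta> * of_real u ^ 2)) = \<bar>u\<bar> ^ k * exp (- Re \<delta> * u\<^sup>2)"
  by (simp add: norm_mult norm_power power_abs flip: of_real_power)

lemma integrable_power_gaussian:
  assumes "Re \<delta> > 0"
  shows "integrable lborel (\<lambda>u::real. complex_of_real u ^ k * exp (- \<delta> * of_real u ^ 2))"
proof (rule Bochner_Integration.integrable_bound)
  show "integrable lborel (\<lambda>u. fact k * exp (1 / (2 * Re \<delta>)) * exp (- (Re \<delta> / 2) * u\<^sup>2))"
    using assms by (intro integrable_mult_right integrable_exp_minus_square) auto
  show "AE u in lborel. norm (complex_of_real u ^ k * exp (- \<delta> * of_real u ^ 2))
      \<le> norm (fact k * exp (1 / (2 * Re \<delta>)) * exp (- (Re \<delta> / 2) * u\<^sup>2))"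
    unfolding norm_power_gaussian using abs_power_exp_minus_square_le[OF assms, of _ k]
    by simp
qed measurable

lemma tendsto_power_gaussian:
  assumes "Re \<delta> > 0" and "F = at_top \<or> F = at_bot"
  shows "((\<lambda>u::real. complex_of_real u ^ k * exp (- \<delta> * of_real u ^ 2)) \<longlongrightarrow> 0) F"
proof (rule Lim_null_comparison)
  show "\<forall>\<^sub>F u in F. norm (complex_of_real u ^ k * exp (- \<delta> * of_real u ^ 2))
      \<le> fact k * exp (1 / (2 * Re \<delta>)) * exp (- (Re \<delta> / 2) * u\<^sup>2)"
    unfolding norm_power_gaussian using abs_power_exp_minus_square_le[OF assms(1), of _ k]
    by simp
  have "filterlim (\<lambda>u::real. u\<^sup>2) at_top F"
    using assms(2) filterlim_pow_at_top[of 2 "\<lambda>u::real. u" at_top] filterlim_ident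
      filterlim_pow_at_bot_even[of 2 "\<lambda>u::real. u" at_bot] by auto
  then have "filterlim (\<lambda>u::real. - (Re \<delta> / 2) * u\<^sup>2) at_bot F"
    using assms(1) by (intro filterlim_tendsto_neg_mult_at_bot[OF tendsto_const]) auto
  then have "((\<lambda>u::real. exp (- (Re \<delta> / 2) * u\<^sup>2)) \<longlongrightarrow> 0) F"
    by (rule filterlim_compose[OF exp_at_bot])
  then show "((\<lambda>u::real. fact k * exp (1 / (2 * Re \<delta>)) * exp (- (Re \<delta> / 2) * u\<^sup>2)) \<longlongrightarrow> 0) F"
    by (rule tendsto_mult_right_zero)
qed

section \<open>Recurrence for the moments by integrating exact derivatives\<close>

definition cgaussian_moment :: "complex \<Rightarrow> nat \<Rightarrow> complex" where
  "cgaussian_moment \<delta> k = (\<integral>u. complex_of_real u ^ k * exp (- \<delta> * of_real u ^ 2) \<partial>lborel)"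

text \<open>The fundamental theorem of calculus on the whole line with vanishing boundary values; it
  replaces integration by parts in the moment recurrence.\<close>

lemma integral_deriv_eq_0:
  fixes f F :: "real \<Rightarrow> complex"
  assumes "\<And>x. (F has_vector_derivative f x) (at x)" and "\<And>x. isCont f x"
    and "integrable lborel f" and "(F \<longlongrightarrow> 0) at_top" and "(F \<longlongrightarrow> 0) at_bot"
  shows "(\<integral>x. f x \<partial>lborel) = 0"
proof -
  have "(LBINT x=-\<infinity>..\<infinity>. f x) = 0 - 0"
  proof (rule interval_integral_FTC_integrable)
    show "set_integrable lborel (einterval (- \<infinity>) \<infinity>) f"
      using assms(3) by (simp add: einterval_eq_UNIV set_integrable_def)
    show "((F \<circ> real_of_ereal) \<longlongrightarrow> 0) (at_right (- \<infinity>))" "((F \<circ> real_of_ereal) \<longlongrightarrow> 0) (at_left \<infinity>)"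
      using assms(4,5) by (simp_all add: ereal_tendsto_simps)
  qed (use assms in auto)
  then show ?thesis
    by (simp add: interval_lebesgue_integral_def einterval_eq_UNIV set_lebesgue_integral_def)
qed

lemma cgaussian_moment_1:
  assumes "Re \<delta> > 0"
  shows "cgaussian_moment \<delta> 1 = 0"
proof -
  let ?g = "\<lambda>k u. complex_of_real u ^ k * exp (- \<delta> * of_real u ^ 2)"
  have "(\<integral>u. - 2 * \<delta> * ?g 1 u \<partial>lborel) = 0"
  proof (rule integral_deriv_eq_0)
    show "(?g 0 has_vector_derivative - 2 * \<delta> * ?g 1 u) (at u)" for u
      by (rule has_vector_derivative_real_field)
         (auto intro!: derivative_eq_intros)
    show "integrable lborel (\<lambda>u. - 2 * \<delta> * ?g 1 u)"
      by (intro integrable_mult_right integrable_power_gaussian assms)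
    show "(?g 0 \<longlongrightarrow> 0) at_top" "(?g 0 \<longlongrightarrow> 0) at_bot"
      by (rule tendsto_power_gaussian[OF assms]; simp)+
  qed (auto intro!: continuous_intros)
  moreover have "\<delta> \<noteq> 0"
    using assms by auto
  ultimately show ?thesis
    unfolding cgaussian_moment_def by simp
qed

text \<open>The derivative of u^(k+1) exp(-\<delta> u^2) integrates to zero, and its two terms are
  multiples of the moments k and k + 2.\<close>

lemma cgaussian_moment_Suc_Suc:
  assumes "Re \<delta> > 0"
  shows "cgaussian_moment \<delta> (Suc (Suc k)) = of_nat (Suc k) / (2 * \<delta>) * cgaussian_moment \<delta> k"
proof -
  let ?g = "\<lambda>k u. complex_of_real u ^ k * exp (- \<delta> * of_real u ^ 2)"
  note int = integrable_power_gaussian[OF assms]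
  have "(\<integral>u. of_nat (Suc k) * ?g k u - 2 * \<delta> * ?g (Suc (Suc k)) u \<partial>lborel) = 0"
  proof (rule integral_deriv_eq_0)
    show "(?g (Suc k) has_vector_derivative of_nat (Suc k) * ?g k u - 2 * \<delta> * ?g (Suc (Suc k)) u) (at u)" for u
      by (rule has_vector_derivative_real_field, (rule derivative_eq_intros refl)+)
         (simp add: algebra_simps)
    show "integrable lborel (\<lambda>u. of_nat (Suc k) * ?g k u - 2 * \<delta> * ?g (Suc (Suc k)) u)"
      by (intro Bochner_Integration.integrable_diff integrable_mult_right int)
    show "(?g (Suc k) \<longlongrightarrow> 0) at_top" "(?g (Suc k) \<longlongrightarrow> 0) at_bot"
      by (rule tendsto_power_gaussian[OF assms]; simp)+
  qed (auto intro!: continuous_intros)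
  also have "(\<integral>u. of_nat (Suc k) * ?g k u - 2 * \<delta> * ?g (Suc (Suc k)) u \<partial>lborel) =
      of_nat (Suc k) * cgaussian_moment \<delta> k - 2 * \<delta> * cgaussian_moment \<delta> (Suc (Suc k))"
    unfolding cgaussian_moment_def
    by (subst Bochner_Integration.integral_diff; (intro integrable_mult_right int)?)
       (simp only: Bochner_Integration.integral_mult_right_zero)
  finally have "2 * \<delta> * cgaussian_moment \<delta> (Suc (Suc k)) = of_nat (Suc k) * cgaussian_moment \<delta> k"
    by simp
  moreover have "\<delta> \<noteq> 0"
    using assms by auto
  ultimately show ?thesis
    by (simp add: field_simps)
qed

section \<open>Zeroth moment for complex \<delta>, by differentiation along vertical lines\<close>

lemma norm_exp_imaginary_minus_1_le: "norm (exp (\<i> * of_real x) - 1) \<le> \<bar>x\<bar>"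
proof -
  have "norm (exp (\<i> * of_real x) - 1) = 2 * \<bar>sin (x / 2)\<bar>"
    by (rule dist_exp_i_1)
  also have "\<dots> \<le> \<bar>x\<bar>"
    using abs_sin_x_le_abs_x[of "x / 2"] by simp
  finally show ?thesis .
qed

text \<open>Rewrites the derivative as a limit of difference quotients, the form in which dominated
  convergence can be applied to it.\<close>

lemma has_vector_derivative_at_iff:
  "(f has_vector_derivative D) (at t) \<longleftrightarrow> ((\<lambda>h. (f (t + h) - f t) /\<^sub>R h) \<longlongrightarrow> D) (at 0)"
proof -
  have "(f has_vector_derivative D) (at t) \<longleftrightarrow>
      ((\<lambda>h. norm (f (t + h) - f t - h *\<^sub>R D) / norm h) \<longlongrightarrow> 0) (at 0)"
    by (simp add: has_vector_derivative_def has_derivative_at bounded_linear_scaleR_left)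
  also have "\<dots> \<longleftrightarrow> ((\<lambda>h. norm ((f (t + h) - f t) /\<^sub>R h - D)) \<longlongrightarrow> 0) (at 0)"
  proof (intro tendsto_cong eventually_at_filter[THEN iffD2] always_eventually allI impI)
    fix h :: real
    assume "h \<noteq> 0"
    then have "(f (t + h) - f t) /\<^sub>R h - D = (f (t + h) - f t - h *\<^sub>R D) /\<^sub>R h"
      by (simp add: scaleR_diff_right)
    then show "norm (f (t + h) - f t - h *\<^sub>R D) / norm h = norm ((f (t + h) - f t) /\<^sub>R h - D)"
      by (simp only: norm_scaleR abs_inverse real_norm_def divide_inverse mult.commute)
  qed
  also have "\<dots> \<longleftrightarrow> ((\<lambda>h. (f (t + h) - f t) /\<^sub>R h) \<longlongrightarrow> D) (at 0)"
    by (simp add: tendsto_norm_zero_iff LIM_zero_iff)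
  finally show ?thesis .
qed

text \<open>Differentiation under the integral sign: the t-derivative of exp(-(d + i t) u^2) brings
  down the factor -i u^2.\<close>

lemma cgaussian_moment_0_has_vector_derivative:
  fixes d t :: real
  assumes "d > 0"
  shows "((\<lambda>t. cgaussian_moment (Complex d t) 0) has_vector_derivative
           - \<i> * cgaussian_moment (Complex d t) 2) (at t)"
proof -
  let ?g = "\<lambda>s k u. complex_of_real u ^ k * exp (- Complex d s * of_real u ^ 2)"
  have int: "integrable lborel (?g s k)" for s k
    using assms by (intro integrable_power_gaussian) simp
  have "((\<lambda>h. (cgaussian_moment (Complex d (t + h)) 0 - cgaussian_moment (Complex d t) 0) /\<^sub>R h)
          \<longlongrightarrow> - \<i> * cgaussian_moment (Complex d t) 2) (at 0)"
    \<comment> \<open>Dominated convergence is a statement about sequences, so the limit is tested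
      along an arbitrary null sequence of nonzero increments.\<close>
    unfolding tendsto_at_iff_sequentially
  proof (intro allI impI)
    fix X :: "nat \<Rightarrow> real"
    assume X: "\<forall>i. X i \<in> UNIV - {0}" "X \<longlonglongrightarrow> 0"
    \<comment> \<open>Shifting the imaginary part of the parameter only multiplies the integrand by
      a phase.\<close>
    have eq: "?g (t + h) 0 u = ?g t 0 u * exp (\<i> * of_real (- h * u\<^sup>2))" for h u
      by (simp add: Complex_eq algebra_simps flip: exp_add)
    have "(\<lambda>i. \<integral>u. (?g (t + X i) 0 u - ?g t 0 u) /\<^sub>R X i \<partial>lborel) \<longlonglongrightarrow> (\<integral>u. - \<i> * ?g t 2 u \<partial>lborel)"
    proof (rule integral_dominated_convergence)
      show "integrable lborel (\<lambda>u. norm (?g t 2 u))"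
        by (intro integrable_norm int)
      show "AE u in lborel. (\<lambda>i. (?g (t + X i) 0 u - ?g t 0 u) /\<^sub>R X i) \<longlonglongrightarrow> - \<i> * ?g t 2 u"
      proof (intro AE_I2)
        fix u :: real
        have "((\<lambda>s. ?g s 0 u) has_vector_derivative - \<i> * ?g t 2 u) (at t)"
          unfolding Complex_eq
          by (auto intro!: derivative_eq_intros has_vector_derivative_real_field simp: algebra_simps)
        then have "((\<lambda>h. (?g (t + h) 0 u - ?g t 0 u) /\<^sub>R h) \<longlongrightarrow> - \<i> * ?g t 2 u) (at 0)"
          by (simp only: has_vector_derivative_at_iff)
        then show "(\<lambda>i. (?g (t + X i) 0 u - ?g t 0 u) /\<^sub>R X i) \<longlonglongrightarrow> - \<i> * ?g t 2 u"
          using X unfolding tendsto_at_iff_sequentially by (auto simp: o_def)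
      qed
      show "AE u in lborel. norm ((?g (t + X i) 0 u - ?g t 0 u) /\<^sub>R X i) \<le> norm (?g t 2 u)" for i
      proof (intro AE_I2)
        fix u :: real
        have "?g (t + X i) 0 u - ?g t 0 u = ?g t 0 u * (exp (\<i> * of_real (- X i * u\<^sup>2)) - 1)"
          unfolding eq by (simp add: algebra_simps)
        then have "norm ((?g (t + X i) 0 u - ?g t 0 u) /\<^sub>R X i) =
            norm (?g t 0 u) * norm (exp (\<i> * of_real (- X i * u\<^sup>2)) - 1) / \<bar>X i\<bar>"
          by (simp only: norm_scaleR norm_mult) (simp add: field_simps)
        \<comment> \<open>A chord of the unit circle is no longer than its arc; the increment then
          cancels, so the bound is the same for all i.\<close>
        also have "\<dots> \<le> norm (?g t 0 u) * \<bar>- X i * u\<^sup>2\<bar> / \<bar>X i\<bar>"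
          by (intro divide_right_mono mult_left_mono norm_exp_imaginary_minus_1_le) auto
        also have "\<dots> = norm (?g t 2 u)"
          using X(1) unfolding norm_power_gaussian by (simp add: abs_mult)
        finally show "norm ((?g (t + X i) 0 u - ?g t 0 u) /\<^sub>R X i) \<le> norm (?g t 2 u)" .
      qed
    qed (measurable)
    also have "(\<integral>u. - \<i> * ?g t 2 u \<partial>lborel) = - \<i> * cgaussian_moment (Complex d t) 2"
      unfolding cgaussian_moment_def by (rule Bochner_Integration.integral_mult_right_zero)
    also have "(\<lambda>i. \<integral>u. (?g (t + X i) 0 u - ?g t 0 u) /\<^sub>R X i \<partial>lborel) =
        (\<lambda>i. (cgaussian_moment (Complex d (t + X i)) 0 - cgaussian_moment (Complex d t) 0) /\<^sub>R X i)"
      unfolding cgaussian_moment_def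
      by (subst integral_scaleR_right, subst Bochner_Integration.integral_diff) (intro int refl)+
    finally show "((\<lambda>h. (cgaussian_moment (Complex d (t + h)) 0 - cgaussian_moment (Complex d t) 0) /\<^sub>R h) \<circ> X)
        \<longlonglongrightarrow> - \<i> * cgaussian_moment (Complex d t) 2"
      by (simp add: o_def)
  qed
  then show ?thesis
    by (simp only: has_vector_derivative_at_iff)
qed


text \<open>Both sides have the same square. Since \<delta> is in the open right half-plane, so is
  \<open>csqrt \<delta>\<close>, hence also its inverse; the right-hand side is therefore the
  principal root, with c = 0 as the trivial boundary case.\<close>

lemma csqrt_of_real_divide:
  assumes "Re \<delta> > 0" and "c \<ge> 0"
  shows "csqrt (of_real c / \<delta>) = of_real (sqrt c) / csqrt \<delta>"
proof (rule csqrt_unique)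
  show "(of_real (sqrt c) / csqrt \<delta>)\<^sup>2 = of_real c / \<delta>"
    using assms by (simp add: power_divide flip: of_real_power del: csqrt.simps)
  have "Re (csqrt \<delta>) \<noteq> 0"
  proof
    assume "Re (csqrt \<delta>) = 0"
    then have "Re ((csqrt \<delta>)\<^sup>2) \<le> 0"
      by (simp only: Re_power2) simp
    with assms(1) show False
      by simp
  qed
  with Re_csqrt[of \<delta>] have "Re (csqrt \<delta>) > 0"
    by linarith
  then show "0 < Re (of_real (sqrt c) / csqrt \<delta>) \<or>
      Re (of_real (sqrt c) / csqrt \<delta>) = 0 \<and> 0 \<le> Im (of_real (sqrt c) / csqrt \<delta>)"
    using assms(2)
    by (cases "c = 0") (auto simp: Re_divide simp del: csqrt.simps intro!: divide_pos_pos add_pos_nonneg)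
qed

text \<open>
  Along the vertical line through \<open>Re \<delta>\<close>, the product of \<open>csqrt\<close> and the zeroth moment is constant,
  which reduces the evaluation to real \<open>\<delta>\<close>.
\<close>

lemma cgaussian_moment_0:
  assumes "Re \<delta> > 0"
  shows "cgaussian_moment \<delta> 0 = csqrt (of_real pi / \<delta>)"
proof -
  define d where "d = Re \<delta>"
  have d: "d > 0"
    using assms by (simp add: d_def)
  define h where "h t = cgaussian_moment (Complex d t) 0 * csqrt (Complex d t)" for t
  have "(h has_vector_derivative 0) (at t)" for t
  proof -
    let ?z = "Complex d t"
    have "?z \<noteq> 0" and z: "?z \<notin> \<real>\<^sub>\<le>\<^sub>0"
      using d by (auto simp: complex_eq_iff complex_nonpos_Reals_iff)
    then have sqrt_z: "csqrt ?z \<noteq> 0"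
      by (simp del: csqrt.simps)
    have "((\<lambda>t. csqrt (of_real d + \<i> * of_real t)) has_vector_derivative \<i> / (2 * csqrt ?z)) (at t)"
      using z unfolding Complex_eq
      by (intro has_vector_derivative_real_field) (auto intro!: derivative_eq_intros)
    then have "((\<lambda>t. csqrt (Complex d t)) has_vector_derivative \<i> / (2 * csqrt ?z)) (at t)"
      by (simp only: Complex_eq)
    from has_vector_derivative_mult[OF cgaussian_moment_0_has_vector_derivative[OF d, of t] this]
    have "(h has_vector_derivative cgaussian_moment ?z 0 * (\<i> / (2 * csqrt ?z)) +
        - \<i> * cgaussian_moment ?z 2 * csqrt ?z) (at t)"
      unfolding h_def .
    \<comment> \<open>The recurrence at k = 0, with the parameter written as the square of its root,
      makes the two terms of the product rule cancel.\<close>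
    also have "cgaussian_moment ?z 2 = cgaussian_moment ?z 0 / (2 * (csqrt ?z)\<^sup>2)"
      using cgaussian_moment_Suc_Suc[of ?z 0] d by (simp only: power2_csqrt) (simp add: numeral_2_eq_2)
    also have "cgaussian_moment ?z 0 * (\<i> / (2 * csqrt ?z)) +
        - \<i> * (cgaussian_moment ?z 0 / (2 * (csqrt ?z)\<^sup>2)) * csqrt ?z = 0"
      using sqrt_z by (simp add: power2_eq_square field_simps del: csqrt.simps)
    finally show ?thesis .
  qed
  then obtain c where c: "\<And>t. h t = c"
    using has_vector_derivative_zero_constant[of UNIV h] by auto
  \<comment> \<open>At t = 0 the moment is the classical real integral, which fixes the constant
    value of \<open>h\<close>.\<close>
  have "cgaussian_moment (Complex d 0) 0 = (\<integral>u. complex_of_real (exp (- d * u\<^sup>2)) \<partial>lborel)"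
    unfolding cgaussian_moment_def
    by (intro Bochner_Integration.integral_cong refl)
       (simp add: Complex_eq exp_of_real flip: of_real_power of_real_mult of_real_minus)
  also have "\<dots> = of_real (sqrt (pi / d))"
    by (subst integral_of_real[OF integrable_exp_minus_square[OF d]])
       (simp only: integral_exp_minus_square[OF d])
  finally have "h 0 = of_real (sqrt (pi / d)) * of_real (sqrt d)"
    unfolding h_def using d by (simp only: complex_of_real_def[symmetric]) (simp add: csqrt_of_real del: csqrt.simps)
  also have "\<dots> = of_real (sqrt pi)"
    using d by (simp add: real_sqrt_divide)
  finally have "h (Im \<delta>) = of_real (sqrt pi)"
    using c by metis
  moreover have "Complex d (Im \<delta>) = \<delta>" "csqrt \<delta> \<noteq> 0"
    using assms by (auto simp: d_def simp del: csqrt.simps)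
  ultimately show ?thesis
    using csqrt_of_real_divide[OF assms, of pi]
    by (metis h_def nonzero_eq_divide_eq pi_ge_zero)
qed

section \<open>Closed form of all moments\<close>

lemma cgaussian_moment_odd:
  assumes "Re \<delta> > 0" and "odd k"
  shows "cgaussian_moment \<delta> k = 0"
proof -
  have "cgaussian_moment \<delta> (2 * m + 1) = 0" for m
    by (induction m) (use assms cgaussian_moment_1 cgaussian_moment_Suc_Suc in auto)
  then show ?thesis
    using assms(2) by (auto elim!: oddE)
qed

lemma cgaussian_moment_even:
  assumes "Re \<delta> > 0"
  shows "cgaussian_moment \<delta> (2 * m) = csqrt (of_real pi / \<delta>) * pochhammer (1 / 2) m / \<delta> ^ m"
proof (induction m)
  case 0
  then show ?case
    using cgaussian_moment_0[OF assms] by simp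
next
  case (Suc m)
  have "\<delta> \<noteq> 0"
    using assms by auto
  have "cgaussian_moment \<delta> (2 * Suc m) = of_nat (Suc (2 * m)) / (2 * \<delta>) * cgaussian_moment \<delta> (2 * m)"
    using cgaussian_moment_Suc_Suc[OF assms, of "2 * m"] by simp
  \<comment> \<open>The recurrence factor is the next factor of the Pochhammer symbol of 1/2,
    divided by \<delta>.\<close>
  also have "of_nat (Suc (2 * m)) / (2 * \<delta>) = (1 / 2 + of_nat m) / \<delta>"
    using \<open>\<delta> \<noteq> 0\<close> by (simp add: field_simps)
  finally show ?case
    unfolding Suc by (simp add: pochhammer_Suc del: csqrt.simps)
qed


section \<open>Growth of the coefficients\<close>

text \<open>Bounds 1/Gamma uniformly on the positive axis. From 3/2 on, Gamma is increasing; for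
  smaller x, two steps of the functional equation reach x + 2 and cost the factor (x + 1) x, which
  is at most 15/4.\<close>

lemma Gamma_real_ge:
  fixes x :: real
  assumes "x > 0"
  shows "Gamma (3/2) / 4 \<le> Gamma x"
proof (cases "x \<ge> 3/2")
  case True
  have "Gamma (3/2) \<le> Gamma x"
    using True Gamma_real_strict_mono[of "3/2" x] by (metis order.order_iff_strict)
  with Gamma_real_pos[OF assms] show ?thesis
    by linarith
next
  case False
  have "x \<notin> \<int>\<^sub>\<le>\<^sub>0" "x + 1 \<notin> \<int>\<^sub>\<le>\<^sub>0"
    using assms nonpos_Ints_nonpos[of x] nonpos_Ints_nonpos[of "x + 1"] by linarith+
  then have Gamma_eq: "Gamma (x + 2) = (x + 1) * x * Gamma x"
    using Gamma_plus1[of x] Gamma_plus1[of "x + 1"] by (simp add: add_ac)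
  have "Gamma (3/2) \<le> Gamma (x + 2)"
    using assms Gamma_real_strict_mono[of "3/2" "x + 2"] by simp
  also have "\<dots> \<le> 4 * Gamma x"
    unfolding Gamma_eq
  proof (rule mult_right_mono)
    have "(x + 1) * x \<le> (5/2) * (3/2)"
      using assms False by (intro mult_mono) auto
    then show "(x + 1) * x \<le> 4"
      by simp
  qed (use assms in \<open>simp add: Gamma_real_pos less_imp_le\<close>)
  finally show ?thesis
    by simp
qed

text \<open>The ratio is a product of r quotients (a + k)/(b + k). These tend to 1 as k grows, hence
  are bounded by some M.\<close>

lemma norm_pochhammer_ratio_le:
  fixes a b :: complex
  assumes "b \<notin> \<int>\<^sub>\<le>\<^sub>0"
  obtains M where "M \<ge> 0" "\<And>r. norm (pochhammer a r / pochhammer b r) \<le> M ^ r"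
proof -
  define g where "g k = norm ((a + of_nat k) / (b + of_nat k))" for k
  have "(\<lambda>k. (a + of_nat k) / (b + of_nat k)) \<longlonglongrightarrow> 1"
  proof -
    have "(\<lambda>k. 1 + (a - b) / (b + of_nat k)) \<longlonglongrightarrow> 1 + 0"
      by (intro tendsto_add tendsto_const tendsto_divide_0[OF tendsto_const]
          tendsto_add_filterlim_at_infinity[OF tendsto_const] tendsto_of_nat)
    moreover have "1 + (a - b) / (b + of_nat k) = (a + of_nat k) / (b + of_nat k)" for k
    proof -
      have "b + of_nat k \<noteq> 0"
        using assms by (metis add_eq_0_iff2 minus_of_nat_in_nonpos_Ints)
      then show ?thesis
        by (simp add: field_simps)
    qed
    ultimately show ?thesis
      by simp
  qed
  then have "Bseq (\<lambda>k. (a + of_nat k) / (b + of_nat k))"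
    by (intro convergent_imp_Bseq) (auto simp: convergent_def)
  then obtain M where M: "M > 0" "\<And>k. g k \<le> M"
    unfolding g_def by (auto elim!: BseqE)
  have "norm (pochhammer a r / pochhammer b r) \<le> M ^ r" for r
  proof (induction r)
    case (Suc r)
    have "norm (pochhammer a (Suc r) / pochhammer b (Suc r)) = norm (pochhammer a r / pochhammer b r) * g r"
      by (simp add: pochhammer_Suc g_def norm_mult norm_divide)
    also have "\<dots> \<le> M ^ r * M"
      using Suc M by (intro mult_mono) (auto simp: g_def)
    finally show ?case
      by (simp add: mult_ac)
  qed simp
  with M(1) show ?thesis
    by (intro that[of M]) auto
qed

text \<open>Upper and lower parameters are paired one to one, and the bases of the geometric bounds
  multiply.\<close>

lemma norm_prod_pochhammer_ratio_le:
  fixes as bs :: "complex list"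
  assumes "length as = length bs" and "\<forall>b\<in>set bs. b \<notin> \<int>\<^sub>\<le>\<^sub>0"
  shows "\<exists>M\<ge>0. \<forall>r. norm ((\<Prod>a\<leftarrow>as. pochhammer a r) / (\<Prod>b\<leftarrow>bs. pochhammer b r)) \<le> M ^ r"
  using assms
proof (induction as bs rule: list_induct2)
  case Nil
  then show ?case
    by (intro exI[of _ 1]) simp
next
  case (Cons a as b bs)
  then obtain M where M: "M \<ge> 0"
    "\<And>r. norm ((\<Prod>a\<leftarrow>as. pochhammer a r) / (\<Prod>b\<leftarrow>bs. pochhammer b r)) \<le> M ^ r"
    by auto
  obtain N where N: "N \<ge> 0" "\<And>r. norm (pochhammer a r / pochhammer b r) \<le> N ^ r"
    using norm_pochhammer_ratio_le[of b a] Cons.prems by auto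
  have "norm ((\<Prod>a\<leftarrow>a # as. pochhammer a r) / (\<Prod>b\<leftarrow>b # bs. pochhammer b r)) \<le> (N * M) ^ r" for r
  proof -
    have "norm (pochhammer a r / pochhammer b r) *
        norm ((\<Prod>a\<leftarrow>as. pochhammer a r) / (\<Prod>b\<leftarrow>bs. pochhammer b r)) \<le> N ^ r * M ^ r"
      using M N by (intro mult_mono) auto
    then show ?thesis
      by (simp add: norm_mult norm_divide power_mult_distrib)
  qed
  then show ?case
    using M N by (intro exI[of _ "N * M"]) auto
qed

definition hypergeom_ML_coeff :: "real \<Rightarrow> real \<Rightarrow> complex list \<Rightarrow> complex list \<Rightarrow> nat \<Rightarrow> complex" where
  "hypergeom_ML_coeff \<alpha> \<beta> as bs r =
     (\<Prod>a\<leftarrow>as. pochhammer a r) / (\<Prod>b\<leftarrow>bs. pochhammer b r) / of_real (Gamma (\<alpha> * real r + \<beta>))"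

lemma hypergeom_ML_eq_suminf:
  "hypergeom_ML \<alpha> \<beta> as bs u = (\<Sum>r. hypergeom_ML_coeff \<alpha> \<beta> as bs r * u ^ r)"
  by (simp add: hypergeom_ML_def hypergeom_ML_coeff_def)

text \<open>
  Prepending the parameter \<open>1\<close> to \<open>as\<close> balances the two lists and contributes \<open>(1)\<^sub>r = r!\<close>.
\<close>

lemma norm_hypergeom_ML_coeff_le:
  assumes "\<alpha> > 0" and "\<beta> > 0" and "length bs = length as + 1" and "\<forall>b\<in>set bs. b \<notin> \<int>\<^sub>\<le>\<^sub>0"
  obtains C M where "C \<ge> 0" "M \<ge> 0"
    "\<And>r. norm (hypergeom_ML_coeff \<alpha> \<beta> as bs r) \<le> C * M ^ r / fact r"
proof -
  \<comment> \<open>The reciprocal of the lower bound for Gamma.\<close>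
  define C where "C = 4 / Gamma (3/2 :: real)"
  have C: "C > 0"
    by (simp add: C_def Gamma_real_pos)
  obtain M where M: "M \<ge> 0"
    "\<And>r. norm ((\<Prod>a\<leftarrow>1 # as. pochhammer a r) / (\<Prod>b\<leftarrow>bs. pochhammer b r)) \<le> M ^ r"
    using norm_prod_pochhammer_ratio_le[of "1 # as" bs] assms by auto
  have "norm (hypergeom_ML_coeff \<alpha> \<beta> as bs r) \<le> C * M ^ r / fact r" for r
  proof -
    let ?P = "norm ((\<Prod>a\<leftarrow>as. pochhammer a r) / (\<Prod>b\<leftarrow>bs. pochhammer b r))"
    have x: "\<alpha> * real r + \<beta> > 0"
      using assms by (intro add_nonneg_pos) auto
    have "1 / Gamma (\<alpha> * real r + \<beta>) \<le> 1 / (Gamma (3/2) / 4)"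
      using Gamma_real_ge[OF x] Gamma_real_pos[OF x] Gamma_real_pos[of "3/2"]
      by (intro divide_left_mono mult_pos_pos) auto
    then have G: "1 / Gamma (\<alpha> * real r + \<beta>) \<le> C"
      by (simp add: C_def)
    have "norm ((\<Prod>a\<leftarrow>1 # as. pochhammer a r) / (\<Prod>b\<leftarrow>bs. pochhammer b r)) = fact r * ?P"
      by (simp add: norm_mult norm_divide flip: pochhammer_fact)
    with M(2)[of r] have P: "?P \<le> M ^ r / fact r"
      by (simp add: field_simps)
    have "norm (hypergeom_ML_coeff \<alpha> \<beta> as bs r) = ?P * (1 / Gamma (\<alpha> * real r + \<beta>))"
      using Gamma_real_pos[OF x] by (simp add: hypergeom_ML_coeff_def norm_divide norm_mult)
    also have "\<dots> \<le> (M ^ r / fact r) * C"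
      using P G M(1) Gamma_real_pos[OF x] by (intro mult_mono) auto
    finally show ?thesis
      by (simp add: mult_ac)
  qed
  with C M(1) show ?thesis
    by (intro that[of C M]) auto
qed


section \<open>Termwise integration\<close>

lemma gaussian_power_series_integral:
  fixes c :: "nat \<Rightarrow> complex"
  assumes "Re \<delta> > 0" and "M \<ge> 0" and "\<And>r. norm (c r) \<le> C * M ^ r / fact r"
  defines "f \<equiv> \<lambda>u::real. exp (- \<delta> * of_real u ^ 2) * (\<Sum>r. c r * of_real u ^ r)"
  shows "integrable lborel f" and "(\<lambda>r. c r * cgaussian_moment \<delta> r) sums (\<integral>u. f u \<partial>lborel)"
proof -
  let ?g = "\<lambda>k u. complex_of_real u ^ k * exp (- \<delta> * of_real u ^ 2)"
  define s where "s n u = (\<Sum>r<n. c r * ?g r u)" for n u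
  \<comment> \<open>Dominates every partial sum: the bounds on the terms sum to C exp(M |u|), which
    half of the Gaussian exponent absorbs.\<close>
  define w where "w u = C * exp (M\<^sup>2 / (2 * Re \<delta>)) * exp (- (Re \<delta> / 2) * u\<^sup>2)" for u :: real
  \<comment> \<open>Forced by the coefficient bound at r = 0.\<close>
  have C: "C \<ge> 0"
    using order_trans[OF norm_ge_zero assms(3)[of 0]] by simp
  have term_le: "norm (c r * of_real u ^ r) \<le> C * ((M * \<bar>u\<bar>) ^ r /\<^sub>R fact r)" for r and u :: real
  proof -
    have "norm (c r) * \<bar>u\<bar> ^ r \<le> C * M ^ r / fact r * \<bar>u\<bar> ^ r"
      by (intro mult_right_mono assms) auto
    then show ?thesis
      by (simp add: norm_mult norm_power power_mult_distrib field_simps)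
  qed
  have sum_exp: "summable (\<lambda>r. C * ((M * \<bar>u\<bar>) ^ r /\<^sub>R fact r))" for u :: real
    by (intro summable_mult summable_exp_generic)
  have summ: "summable (\<lambda>r. c r * complex_of_real u ^ r)" for u :: real
    by (rule summable_comparison_test[OF _ sum_exp[of u]]) (use term_le in blast)
  have s_eq: "s n u = exp (- \<delta> * of_real u ^ 2) * (\<Sum>r<n. c r * of_real u ^ r)" for n u
    by (simp add: s_def sum_distrib_left mult_ac)
  have lim: "AE u in lborel. (\<lambda>n. s n u) \<longlonglongrightarrow> f u"
    unfolding s_eq f_def by (intro AE_I2 tendsto_mult_left summable_LIMSEQ summ)
  have bound: "AE u in lborel. norm (s n u) \<le> w u" for n
  proof (rule AE_I2)
    fix u :: real
    have "norm (\<Sum>r<n. c r * complex_of_real u ^ r) \<le> (\<Sum>r<n. C * ((M * \<bar>u\<bar>) ^ r /\<^sub>R fact r))"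
      by (intro sum_norm_le term_le)
    also have "\<dots> \<le> (\<Sum>r. C * ((M * \<bar>u\<bar>) ^ r /\<^sub>R fact r))"
      using C assms(2) by (intro sum_le_suminf sum_exp) auto
    also have "\<dots> = C * exp (M * \<bar>u\<bar>)"
      unfolding exp_def by (intro suminf_mult summable_exp_generic)
    finally have "norm (s n u) \<le> exp (- Re \<delta> * u\<^sup>2) * (C * exp (M * \<bar>u\<bar>))"
      unfolding s_eq norm_mult using norm_power_gaussian[of u 0 \<delta>] by (simp add: mult_left_mono)
    also have "\<dots> = C * (exp (- Re \<delta> * u\<^sup>2) * exp (M * \<bar>u\<bar>))"
      by (simp add: mult_ac)
    also have "\<dots> \<le> w u"
      unfolding w_def mult.assoc
      by (intro mult_left_mono exp_linear_minus_square_le assms C)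
    finally show "norm (s n u) \<le> w u" .
  qed
  have w: "integrable lborel w"
    unfolding w_def using assms(1) by (intro integrable_mult_right integrable_exp_minus_square) auto
  have s_meas: "s n \<in> borel_measurable lborel" for n
    unfolding s_def by measurable
  have f_meas: "f \<in> borel_measurable lborel"
    by (rule borel_measurable_LIMSEQ_metric[OF s_meas])
       (use summ in \<open>auto simp: s_eq f_def intro!: tendsto_mult_left summable_LIMSEQ\<close>)
  show "integrable lborel f"
    by (rule integrable_dominated_convergence[OF f_meas s_meas w lim bound])
  have "(\<lambda>n. \<integral>u. s n u \<partial>lborel) \<longlonglongrightarrow> (\<integral>u. f u \<partial>lborel)"
    by (rule integral_dominated_convergence[OF f_meas s_meas w lim bound])
  moreover have "(\<integral>u. s n u \<partial>lborel) = (\<Sum>r<n. c r * cgaussian_moment \<delta> r)" for n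
    unfolding s_def cgaussian_moment_def
    using integrable_power_gaussian[OF assms(1)]
    by (subst Bochner_Integration.integral_sum) auto
  ultimately show "(\<lambda>r. c r * cgaussian_moment \<delta> r) sums (\<integral>u. f u \<partial>lborel)"
    by (simp add: sums_def)
qed

section \<open>Duplication formula and evaluation of the integral\<close>

lemma prod_list_pochhammer_halves:
  "(\<Prod>a\<leftarrow>as. pochhammer a (2 * m)) = 4 ^ (m * length as) * (\<Prod>a\<leftarrow>halves as. pochhammer a m)"
proof (induction as)
  case Nil
  then show ?case
    by (simp add: halves_def)
next
  case (Cons a as)
  have "pochhammer a (2 * m) = 4 ^ m * (pochhammer (a / 2) m * pochhammer ((a + 1) / 2) m)"
    using pochhammer_double[of "a / 2" m] by (simp add: power_mult add_divide_distrib)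
  then show ?case
    using Cons by (simp add: halves_def power_add mult_ac)
qed

theorem theorem10:
  fixes \<alpha> \<beta> :: real and \<delta> :: complex and as bs :: "complex list" and q :: nat
  assumes "\<alpha> > 0" and "\<beta> > 0" and "Re \<delta> > 0"
    and "length as = q" and "length bs = q + 1"
    and "\<forall>b\<in>set bs. b \<notin> \<int>\<^sub>\<le>\<^sub>0"
  shows "has_bochner_integral lborel
           (\<lambda>u::real. exp (- \<delta> * of_real u ^ 2) * hypergeom_ML \<alpha> \<beta> as bs (of_real u))
           (csqrt (of_real pi / \<delta>) *
              hypergeom_ML (2 * \<alpha>) \<beta> (halves as @ [1 / 2]) (halves bs) (1 / (4 * \<delta>)))"
proof -
  let ?f = "\<lambda>u::real. exp (- \<delta> * of_real u ^ 2) * hypergeom_ML \<alpha> \<beta> as bs (of_real u)"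
  let ?c = "hypergeom_ML_coeff \<alpha> \<beta> as bs"
  let ?c' = "hypergeom_ML_coeff (2 * \<alpha>) \<beta> (halves as @ [1 / 2]) (halves bs)"
  let ?K = "csqrt (of_real pi / \<delta>)"
  have \<delta>: "\<delta> \<noteq> 0"
    using assms(3) by auto
  obtain C M where CM: "M \<ge> 0" "\<And>r. norm (?c r) \<le> C * M ^ r / fact r"
    using norm_hypergeom_ML_coeff_le[of \<alpha> \<beta> bs as] assms by metis
  note series = gaussian_power_series_integral[OF assms(3) CM, folded hypergeom_ML_eq_suminf]
  \<comment> \<open>Odd moments vanish, so the series may be reindexed along the even
    indices.\<close>
  have "(\<lambda>m. ?c (2 * m) * cgaussian_moment \<delta> (2 * m)) sums (\<integral>u. ?f u \<partial>lborel)"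
    using series(2)
  proof (subst sums_mono_reindex)
    show "?c r * cgaussian_moment \<delta> r = 0" if "r \<notin> range ((*) 2)" for r
      using that cgaussian_moment_odd[OF assms(3), of r] by (auto elim!: evenE)
  qed (auto simp: strict_mono_def)
  moreover have "?c (2 * m) * cgaussian_moment \<delta> (2 * m) = ?K * (?c' m * (1 / (4 * \<delta>)) ^ m)" for m
  proof -
    \<comment> \<open>Duplication yields 4^m per parameter; the extra entry of \<open>bs\<close>
      leaves one uncancelled 4^m in the denominator.\<close>
    have "4 ^ (m * length bs) = (4 :: complex) ^ (m * length as) * 4 ^ m"
      using assms(4,5) by (simp add: power_add)
    then have c: "?c (2 * m) = (\<Prod>a\<leftarrow>halves as. pochhammer a m) / (\<Prod>b\<leftarrow>halves bs. pochhammer b m)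
        / 4 ^ m / of_real (Gamma (2 * \<alpha> * real m + \<beta>))"
      unfolding hypergeom_ML_coeff_def prod_list_pochhammer_halves by (simp add: mult_ac)
    \<comment> \<open>The Pochhammer symbol of 1/2 in the even moment becomes the additional upper
      parameter.\<close>
    show ?thesis
      unfolding cgaussian_moment_even[OF assms(3)] c
      by (simp add: hypergeom_ML_coeff_def power_divide power_mult_distrib mult_ac del: csqrt.simps)
  qed
  ultimately have sums: "(\<lambda>m. ?K * (?c' m * (1 / (4 * \<delta>)) ^ m)) sums (\<integral>u. ?f u \<partial>lborel)"
    by (simp del: csqrt.simps)
  \<comment> \<open>Dividing by the nonzero prefactor transfers summability to the right-hand
    series, so that the prefactor may be pulled out of its sum.\<close>
  have "?K \<noteq> 0"
    using \<delta> by (simp del: csqrt.simps)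
  then have "summable (\<lambda>m. ?c' m * (1 / (4 * \<delta>)) ^ m)"
    using sums_summable[OF sums] by (simp only: summable_cmult_iff) blast
  then have "(\<integral>u. ?f u \<partial>lborel) = ?K * hypergeom_ML (2 * \<alpha>) \<beta> (halves as @ [1 / 2]) (halves bs) (1 / (4 * \<delta>))"
    using sums_unique[OF sums] suminf_mult[of "\<lambda>m. ?c' m * (1 / (4 * \<delta>)) ^ m" ?K]
    unfolding hypergeom_ML_eq_suminf by metis
  with series(1) show ?thesis
    by (simp only: has_bochner_integral_iff)
qed

end
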